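(* Let $n>1$ and $m,t\ge 1$ be integers, and let $G\le S_n$, $H\le S_m$, $K\le S_t$ be transitive permutation groups. Let $\Delta_1,\Delta_2$ be self-paired orbitals of $G$, let $\Delta_3$ be any orbital of $G$, let $\Delta_4$ be a self-paired orbital of $H$ which is non-diagonal if $\Delta_1$ is diagonal, and let $\Delta_5$ be a self-paired orbital of $K$ which is non-diagonal if $\Delta_2$ is diagonal. Let $\Gamma=\Gamma(\Delta_1,\Delta_2,\Delta_3,\Delta_4,\Delta_5)$ be the graph defined in the context, with vertex set $V\cup U$. Then $\Gamma$ admits $G\times H\times K$ (with the action given in the context) as a subgroup of its automorphism group having two vertex orbits and three edge orbits. Moreover, $\Gamma$ is not a graph with $(o_v,o_e)=(2,3)$ if and only if there exists an automorphism of $\Gamma$ mapping some vertex from $V$ to some vertex from $U$.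
   Context: All graphs are finite. $o_v(\Gamma)$ and $o_e(\Gamma)$ denote the numbers of orbits of the full automorphism group $\mathrm{Aut}(\Gamma)$ on the vertex set and on the edge set of $\Gamma$, respectively. A permutation group $G\le S_n$ is regarded as acting on $\mathbb{Z}_n$. For a transitive $G\le S_n$, its orbitals are the orbits of the component-wise action of $G$ on $\mathbb{Z}_n\times\mathbb{Z}_n$. The diagonal orbital is $\{(i,i): i\in\mathbb{Z}_n\}$; all other orbitals are non-diagonal. An orbital $\Delta$ is self-paired if $(x,y)\in\Delta$ implies $(y,x)\in\Delta$. The same definitions apply to $H\le S_m$ acting on $\mathbb{Z}_m$ and $K\le S_t$ acting on $\mathbb{Z}_t$. The graph $\Gamma=\Gamma(\Delta_1,\Delta_2,\Delta_3,\Delta_4,\Delta_5)$ is the undirected graph of order $n(m+t)$ with vertex set $V\cup U$ (disjoint), where $V=\{v_i^j: i\in\mathbb{Z}_n, j\in\mathbb{Z}_m\}$ and $U=\{u_i^j: i\in\mathbb{Z}_n, j\in\mathbb{Z}_t\}$, and edge set $E_1\cup E_2\cup E_3$, where $E_1=\{v_i^jv_{i'}^{j'}: (i,i')\in\Delta_1,\ (j,j')\in\Delta_4\}$, $E_2=\{u_i^ju_{i'}^{j'}: (i,i')\in\Delta_2,\ (j,j')\in\Delta_5\}$, $E_3=\{v_i^ju_{i'}^{j'}: (i,i')\in\Delta_3,\ j\in\mathbb{Z}_m,\ j'\in\mathbb{Z}_t\}$. The group $G\times H\times K$ acts on $V\cup U$ by $(g,h,k)(v_i^j)=v_{g(i)}^{h(j)}$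 and $(g,h,k)(u_i^j)=u_{g(i)}^{k(j)}$. *)

theory Defs
  imports "HOL-Algebra.Group_Action"
begin

text \<open>
  The set \<open>\<int>\<^sub>n\<close> is only used as a set of \<open>n\<close> points; it is \<open>{0..<n}\<close>, and the symmetric group
  on it is \<open>BijGroup {0..<n}\<close>, whose elements are extensional functions.
\<close>

definition Zset :: "nat \<Rightarrow> nat set" where
  "Zset n = {0..<n}"

definition perm_grp :: "nat \<Rightarrow> (nat \<Rightarrow> nat) set \<Rightarrow> (nat \<Rightarrow> nat) monoid" where
  "perm_grp n G = (BijGroup (Zset n))\<lparr>carrier := G\<rparr>"

definition transitive_perm_group :: "nat \<Rightarrow> (nat \<Rightarrow> nat) set \<Rightarrow> bool" where
  "transitive_perm_group n G \<longleftrightarrow>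
     subgroup G (BijGroup (Zset n)) \<and> transitive_action (perm_grp n G) (Zset n) (\<lambda>g. g)"

definition orbitals :: "nat \<Rightarrow> (nat \<Rightarrow> nat) set \<Rightarrow> (nat \<times> nat) set set" where
  "orbitals n G = orbits (perm_grp n G) (Zset n \<times> Zset n) (\<lambda>g (x, y). (g x, g y))"

text \<open>An orbital is self-paired iff it is symmetric as a relation, i.e. satisfies \<^const>\<open>sym\<close>.\<close>

definition diagonal_orbital :: "nat \<Rightarrow> (nat \<times> nat) set" where
  "diagonal_orbital n = {(i, i) | i. i \<in> Zset n}"

text \<open>Undirected graphs: an edge joining \<open>x\<close> and \<open>y\<close> is the unordered pair \<open>{x, y}\<close>.\<close>

record 'a ugraph =
  verts :: "'a set"
  edges :: "'a set set"

definition simple_graph :: "'a ugraph \<Rightarrow> bool" where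
  "simple_graph \<Gamma> \<longleftrightarrow> finite (verts \<Gamma>) \<and> (\<forall>e\<in>edges \<Gamma>. e \<subseteq> verts \<Gamma> \<and> card e = 2)"

definition Aut :: "'a ugraph \<Rightarrow> ('a \<Rightarrow> 'a) monoid" where
  "Aut \<Gamma> = (BijGroup (verts \<Gamma>))\<lparr>carrier :=
     {f \<in> Bij (verts \<Gamma>). \<forall>x\<in>verts \<Gamma>. \<forall>y\<in>verts \<Gamma>.
        {x, y} \<in> edges \<Gamma> \<longleftrightarrow> {f x, f y} \<in> edges \<Gamma>}\<rparr>"

definition o_v :: "'a ugraph \<Rightarrow> nat" where
  "o_v \<Gamma> = card (orbits (Aut \<Gamma>) (verts \<Gamma>) (\<lambda>f. f))"

definition o_e :: "'a ugraph \<Rightarrow> nat" where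
  "o_e \<Gamma> = card (orbits (Aut \<Gamma>) (edges \<Gamma>) (\<lambda>f e. f ` e))"

text \<open>\<open>Vv i j\<close> is the vertex \<open>v\<^sub>i\<^sup>j\<close> and \<open>Uu i j\<close> is the vertex \<open>u\<^sub>i\<^sup>j\<close>.\<close>

datatype vertex = Vv nat nat | Uu nat nat

definition Vset :: "nat \<Rightarrow> nat \<Rightarrow> vertex set" where
  "Vset n m = {Vv i j | i j. i \<in> Zset n \<and> j \<in> Zset m}"

definition Uset :: "nat \<Rightarrow> nat \<Rightarrow> vertex set" where
  "Uset n t = {Uu i j | i j. i \<in> Zset n \<and> j \<in> Zset t}"

definition Gamma ::
  "nat \<Rightarrow> nat \<Rightarrow> nat \<Rightarrow> (nat \<times> nat) set \<Rightarrow> (nat \<times> nat) set \<Rightarrow> (nat \<times> nat) set \<Rightarrow>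
   (nat \<times> nat) set \<Rightarrow> (nat \<times> nat) set \<Rightarrow> vertex ugraph" where
  "Gamma n m t \<Delta>1 \<Delta>2 \<Delta>3 \<Delta>4 \<Delta>5 =
     \<lparr>verts = Vset n m \<union> Uset n t,
      edges = {{Vv i j, Vv i' j'} | i j i' j'. (i, i') \<in> \<Delta>1 \<and> (j, j') \<in> \<Delta>4}
            \<union> {{Uu i j, Uu i' j'} | i j i' j'. (i, i') \<in> \<Delta>2 \<and> (j, j') \<in> \<Delta>5}
            \<union> {{Vv i j, Uu i' j'} | i j i' j'. (i, i') \<in> \<Delta>3 \<and> j \<in> Zset m \<and> j' \<in> Zset t}\<rparr>"

text \<open>The restriction to \<open>V \<union> U\<close> makes the permutation extensional, as \<^const>\<open>Bij\<close> requires.\<close>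

definition GHK_act ::
  "nat \<Rightarrow> nat \<Rightarrow> nat \<Rightarrow> (nat \<Rightarrow> nat) \<times> (nat \<Rightarrow> nat) \<times> (nat \<Rightarrow> nat) \<Rightarrow> vertex \<Rightarrow> vertex" where
  "GHK_act n m t = (\<lambda>(g, h, k). \<lambda>x \<in> Vset n m \<union> Uset n t.
     case x of Vv i j \<Rightarrow> Vv (g i) (h j) | Uu i j \<Rightarrow> Uu (g i) (k j))"

lemma subgroup_Aut: "subgroup (carrier (Aut \<Gamma>)) (BijGroup (verts \<Gamma>))"
proof -
  interpret B: group "BijGroup (verts \<Gamma>)" by (rule group_BijGroup)
  show ?thesis
  proof (rule B.subgroupI)
    show "carrier (Aut \<Gamma>) \<subseteq> carrier (BijGroup (verts \<Gamma>))"
      by (auto simp: Aut_def BijGroup_def)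
    have "(\<lambda>x\<in>verts \<Gamma>. x) \<in> carrier (Aut \<Gamma>)"
      by (auto simp: Aut_def id_Bij)
    then show "carrier (Aut \<Gamma>) \<noteq> {}" by blast
  next
    fix f assume f: "f \<in> carrier (Aut \<Gamma>)"
    then have fB: "f \<in> Bij (verts \<Gamma>)" by (simp add: Aut_def)
    let ?h = "\<lambda>x\<in>verts \<Gamma>. inv_into (verts \<Gamma>) f x"
    have mem: "?h x \<in> verts \<Gamma> \<and> f (?h x) = x" if "x \<in> verts \<Gamma>" for x
      using fB that by (simp add: Bij_inv_into_mem Bij_def bij_betw_def f_inv_into_f)
    have "?h \<in> carrier (Aut \<Gamma>)"
      using f mem restrict_inv_into_Bij[OF fB] by (auto simp: Aut_def)
    then show "inv\<^bsub>BijGroup (verts \<Gamma>)\<^esub> f \<in> carrier (Aut \<Gamma>)"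
      by (simp add: inv_BijGroup[OF fB])
  next
    fix f g assume "f \<in> carrier (Aut \<Gamma>)" "g \<in> carrier (Aut \<Gamma>)"
    then show "f \<otimes>\<^bsub>BijGroup (verts \<Gamma>)\<^esub> g \<in> carrier (Aut \<Gamma>)"
      using compose_Bij[of f "verts \<Gamma>" g] Bij_imp_funcset[of g "verts \<Gamma>"]
      by (auto simp: Aut_def BijGroup_def compose_eq Pi_iff)
  qed
qed

lemma transitive_perm_group_iff:
  "transitive_perm_group n G \<longleftrightarrow>
     subgroup G (BijGroup (Zset n)) \<and> (\<forall>i\<in>Zset n. \<forall>j\<in>Zset n. \<exists>g\<in>G. g i = j)"
proof
  assume *: "transitive_perm_group n G"
  then show "subgroup G (BijGroup (Zset n)) \<and> (\<forall>i\<in>Zset n. \<forall>j\<in>Zset n. \<exists>g\<in>G. g i = j)"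
    using transitive_action.unique_orbit[of "perm_grp n G" "Zset n" "\<lambda>g. g"]
    by (simp add: transitive_perm_group_def perm_grp_def)
next
  assume *: "subgroup G (BijGroup (Zset n)) \<and> (\<forall>i\<in>Zset n. \<forall>j\<in>Zset n. \<exists>g\<in>G. g i = j)"
  then have "group (perm_grp n G)"
    unfolding perm_grp_def by (simp add: subgroup.subgroup_is_group group_BijGroup)
  moreover have "(\<lambda>g. g) \<in> hom (perm_grp n G) (BijGroup (Zset n))"
    using * subgroup.subset by (fastforce simp: hom_def perm_grp_def)
  ultimately have "group_action (perm_grp n G) (Zset n) (\<lambda>g. g)"
    by (simp add: group_action_def group_hom_def group_hom_axioms_def group_BijGroup)
  then show "transitive_perm_group n G"
    using * by (simp add: transitive_perm_group_def transitive_action_def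
      transitive_action_axioms_def perm_grp_def)
qed

lemma orbital_nondiag:
  assumes "transitive_perm_group n G"
    and "\<Delta> \<in> orbitals n G" "\<Delta> \<noteq> diagonal_orbital n" "(x, y) \<in> \<Delta>"
  shows "x \<noteq> y"
proof
  assume "x = y"
  obtain a b where ab: "a \<in> Zset n" "b \<in> Zset n"
    and D: "\<Delta> = {(g a, g b) | g. g \<in> G}"
    using assms(2) by (auto simp: orbitals_def orbits_def orbit_def perm_grp_def)
  have GB: "G \<subseteq> Bij (Zset n)"
    using subgroup.subset assms(1) unfolding transitive_perm_group_def
    by (fastforce simp: BijGroup_def)
  obtain g where "g \<in> G" "g a = g b" using D assms(4) \<open>x = y\<close> by auto
  with GB ab have "a = b" by (auto simp: Bij_def bij_betw_def dest: inj_onD)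
  moreover have "\<exists>g\<in>G. g a = i" if "i \<in> Zset n" for i
    using transitive_action.unique_orbit[of "perm_grp n G" "Zset n" "\<lambda>g. g" a i] assms(1) ab that
    by (simp add: transitive_perm_group_def perm_grp_def)
  moreover have "g a \<in> Zset n" if "g \<in> G" for g
    using GB ab that Bij_imp_funcset by blast
  ultimately have "\<Delta> = diagonal_orbital n"
    unfolding D diagonal_orbital_def by fastforce
  with assms(3) show False by simp
qed

lemma orbital_subset:
  assumes "transitive_perm_group n G" "\<Delta> \<in> orbitals n G"
  shows "\<Delta> \<subseteq> Zset n \<times> Zset n"
proof -
  have "G \<subseteq> Bij (Zset n)"
    using subgroup.subset assms(1) unfolding transitive_perm_group_def
    by (fastforce simp: BijGroup_def)
  then show ?thesis
    using assms(2) Bij_imp_funcset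
    by (fastforce simp: orbitals_def orbits_def orbit_def perm_grp_def)
qed

lemma simple_graph_Gamma:
  assumes "transitive_perm_group n G" "transitive_perm_group m H" "transitive_perm_group t K"
    and "\<Delta>1 \<in> orbitals n G" "\<Delta>2 \<in> orbitals n G" "\<Delta>3 \<in> orbitals n G"
    and "\<Delta>4 \<in> orbitals m H" "\<Delta>1 = diagonal_orbital n \<longrightarrow> \<Delta>4 \<noteq> diagonal_orbital m"
    and "\<Delta>5 \<in> orbitals t K" "\<Delta>2 = diagonal_orbital n \<longrightarrow> \<Delta>5 \<noteq> diagonal_orbital t"
  shows "simple_graph (Gamma n m t \<Delta>1 \<Delta>2 \<Delta>3 \<Delta>4 \<Delta>5)"
proof -
  have nd: "x \<noteq> y" if "transitive_perm_group l L" "\<Delta> \<in> orbitals l L"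
    "\<Delta> \<noteq> diagonal_orbital l" "(x, y) \<in> \<Delta>" for l L \<Delta> x y
    using orbital_nondiag that by blast
  have 1: "Vv i j \<noteq> Vv i' j'" if "(i, i') \<in> \<Delta>1" "(j, j') \<in> \<Delta>4" for i j i' j'
    using nd[OF assms(1,4)] nd[OF assms(2,7)] assms(8) that by blast
  have 2: "Uu i j \<noteq> Uu i' j'" if "(i, i') \<in> \<Delta>2" "(j, j') \<in> \<Delta>5" for i j i' j'
    using nd[OF assms(1,5)] nd[OF assms(3,9)] assms(10) that by blast
  note sub = orbital_subset[OF assms(1,4)] orbital_subset[OF assms(1,5)]
    orbital_subset[OF assms(1,6)] orbital_subset[OF assms(2,7)] orbital_subset[OF assms(3,9)]
  have eqs: "Vset n m = (\<lambda>(i, j). Vv i j) ` (Zset n \<times> Zset m)"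
    "Uset n t = (\<lambda>(i, j). Uu i j) ` (Zset n \<times> Zset t)"
    by (auto simp: Vset_def Uset_def)
  have "finite (Vset n m \<union> Uset n t)"
    unfolding eqs by (simp add: Zset_def)
  moreover have "e \<subseteq> Vset n m \<union> Uset n t \<and> card e = 2"
    if "e \<in> edges (Gamma n m t \<Delta>1 \<Delta>2 \<Delta>3 \<Delta>4 \<Delta>5)" for e
  proof -
    from that consider
      (a) i j i' j' where "e = {Vv i j, Vv i' j'}" "(i, i') \<in> \<Delta>1" "(j, j') \<in> \<Delta>4"
    | (b) i j i' j' where "e = {Uu i j, Uu i' j'}" "(i, i') \<in> \<Delta>2" "(j, j') \<in> \<Delta>5"
    | (c) i j i' j' where "e = {Vv i j, Uu i' j'}" "(i, i') \<in> \<Delta>3" "j \<in> Zset m" "j' \<in> Zset t"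
      unfolding Gamma_def by auto
    then show ?thesis
    proof cases
      case a
      then show ?thesis using 1[OF a(2,3)] sub by (auto simp: Vset_def card_2_iff)
    next
      case b
      then show ?thesis using 2[OF b(2,3)] sub by (auto simp: Uset_def card_2_iff)
    next
      case c
      then show ?thesis using sub by (auto simp: Vset_def Uset_def card_2_iff)
    qed
  qed
  ultimately show ?thesis
    by (auto simp: simple_graph_def Gamma_def)
qed

end

theory Submission
  imports Defs
begin

text \<open>
  The group \<open>G \<times> H \<times> K\<close> can move the two coordinates of a vertex independently. Because an orbital
  is a single orbit on pairs and a transitive group is a single orbit on points, this gives it the
  two vertex orbits \<open>V\<close> and \<open>U\<close> and the three edge orbits \<open>E\<^sub>1\<close>, \<open>E\<^sub>2\<close> and \<open>E\<^sub>3\<close>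
  (\<open>orbits_GHK_verts\<close>, \<open>orbits_GHK_edges\<close>). It acts by automorphisms, since orbitals are invariant,
  and faithfully, since \<open>n\<close>, \<open>m\<close> and \<open>t\<close> are positive (\<open>GHK_act_mon\<close>).

  Every orbit of the full automorphism group is therefore a union of these sets. If some
  automorphism takes a vertex of \<open>V\<close> into \<open>U\<close>, then \<open>V\<close> and \<open>U\<close> fuse and \<open>o_v \<Gamma> = 1\<close>
  (\<open>o_v_fused\<close>). If none does, then, by passing to inverses, every automorphism preserves both \<open>V\<close>
  and \<open>U\<close>. The three kinds of edges are told apart by whether they lie inside \<open>V\<close>, lie inside \<open>U\<close>,
  or do neither, so they are preserved as well. Hence the full group has the same orbits as
  \<open>G \<times> H \<times> K\<close> and \<open>(o_v, o_e) = (2, 3)\<close> (\<open>o_v_o_e_unfused\<close>).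
\<close>

section \<open>Orbits and orbitals\<close>

lemma orbits_eqI:
  assumes "\<Union>Ps = E" "{} \<notin> Ps" "\<And>A x. A \<in> Ps \<Longrightarrow> x \<in> A \<Longrightarrow> orbit G \<phi> x = A"
  shows "orbits G E \<phi> = Ps"
proof
  show "orbits G E \<phi> \<subseteq> Ps"
    using assms(1,3) by (auto simp: orbits_def)
  show "Ps \<subseteq> orbits G E \<phi>"
  proof
    fix A assume "A \<in> Ps"
    moreover from this assms(2) obtain x where "x \<in> A" by (metis ex_in_conv)
    ultimately show "A \<in> orbits G E \<phi>"
      using assms(1,3) unfolding orbits_def by blast
  qed
qed

text \<open>
  For comparing \<open>G \<times> H \<times> K\<close> with the full automorphism group: \<open>\<phi>\<close> is the map into the larger group
  and \<open>F\<close> the action of the latter, on vertices or on edges.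
\<close>

lemma orbit_mono_image:
  assumes "\<phi> ` carrier G \<subseteq> carrier A"
  shows "orbit G (\<lambda>g. F (\<phi> g)) x \<subseteq> orbit A F x"
  using assms by (auto simp: orbit_def)

lemma perm_grp_carrier [simp]: "carrier (perm_grp n G) = G"
  by (simp add: perm_grp_def)

context
  fixes n :: nat and G :: "(nat \<Rightarrow> nat) set"
  assumes G: "transitive_perm_group n G"
begin

lemma perm_group_subset: "G \<subseteq> Bij (Zset n)"
  using subgroup.subset G unfolding transitive_perm_group_def
  by (fastforce simp: BijGroup_def)

lemma perm_group_closed: "g \<in> G \<Longrightarrow> x \<in> Zset n \<Longrightarrow> g x \<in> Zset n"
  using perm_group_subset Bij_imp_funcset by blast

lemma perm_group_transitive: "x \<in> Zset n \<Longrightarrow> y \<in> Zset n \<Longrightarrow> \<exists>g\<in>G. g x = y"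
  using G by (simp add: transitive_perm_group_iff)

lemma perm_group_compose:
  assumes "f \<in> G" "g \<in> G"
  shows "compose (Zset n) f g \<in> G"
proof -
  have "f \<otimes>\<^bsub>BijGroup (Zset n)\<^esub> g \<in> G"
    using G assms subgroup.m_closed by (fastforce simp: transitive_perm_group_def)
  then show ?thesis
    using assms perm_group_subset by (simp add: BijGroup_def subset_iff)
qed

lemma perm_group_inverse:
  assumes "g \<in> G"
  shows "\<exists>g'\<in>G. \<forall>x\<in>Zset n. g' (g x) = x"
proof
  have gB: "g \<in> Bij (Zset n)" using assms perm_group_subset by blast
  have "inv\<^bsub>BijGroup (Zset n)\<^esub> g \<in> G"
    using G assms subgroup.m_inv_closed by (fastforce simp: transitive_perm_group_def)
  then show "(\<lambda>x\<in>Zset n. inv_into (Zset n) g x) \<in> G"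
    using inv_BijGroup[OF gB] by simp
  show "\<forall>x\<in>Zset n. (\<lambda>x\<in>Zset n. inv_into (Zset n) g x) (g x) = x"
    using gB perm_group_closed[OF assms] by (auto simp: Bij_def bij_betw_def)
qed

lemma perm_grp_group: "group (perm_grp n G)"
  using G unfolding perm_grp_def transitive_perm_group_def
  by (simp add: subgroup.subgroup_is_group group_BijGroup)

lemma perm_grp_mult:
  "f \<in> G \<Longrightarrow> g \<in> G \<Longrightarrow> f \<otimes>\<^bsub>perm_grp n G\<^esub> g = compose (Zset n) f g"
  using perm_group_subset by (simp add: perm_grp_def BijGroup_def subset_iff)

lemma orbitalE:
  assumes "\<Delta> \<in> orbitals n G"
  obtains a b where "a \<in> Zset n" "b \<in> Zset n" "\<Delta> = {(g a, g b) | g. g \<in> G}"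
  using assms by (auto simp: orbitals_def orbits_def orbit_def perm_grp_def)

lemma orbital_nonempty:
  assumes "\<Delta> \<in> orbitals n G"
  shows "\<Delta> \<noteq> {}"
  using assms
proof (rule orbitalE)
  fix a b assume "a \<in> Zset n" "\<Delta> = {(g a, g b) | g. g \<in> G}"
  then show ?thesis using perm_group_transitive by blast
qed

lemma orbital_image:
  assumes "\<Delta> \<in> orbitals n G" "g \<in> G" "(x, y) \<in> \<Delta>"
  shows "(g x, g y) \<in> \<Delta>"
  using assms(1)
proof (rule orbitalE)
  fix a b assume ab: "a \<in> Zset n" "b \<in> Zset n" and D: "\<Delta> = {(g a, g b) | g. g \<in> G}"
  then obtain f where f: "f \<in> G" "x = f a" "y = f b" using assms(3) by blast
  have "compose (Zset n) g f \<in> G" "g x = compose (Zset n) g f a" "g y = compose (Zset n) g f b"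
    using perm_group_compose assms(2) f ab by (auto simp: compose_eq)
  then show ?thesis unfolding D by blast
qed

lemma orbital_invariant:
  assumes "\<Delta> \<in> orbitals n G" "g \<in> G" "x \<in> Zset n" "y \<in> Zset n"
  shows "(g x, g y) \<in> \<Delta> \<longleftrightarrow> (x, y) \<in> \<Delta>"
proof
  obtain g' where g': "g' \<in> G" "\<forall>x\<in>Zset n. g' (g x) = x"
    using perm_group_inverse assms(2) by blast
  assume "(g x, g y) \<in> \<Delta>"
  from orbital_image[OF assms(1) g'(1) this] show "(x, y) \<in> \<Delta>"
    using g'(2) assms(3,4) by simp
qed (rule orbital_image[OF assms(1,2)])

text \<open>
  Both pairs are images of one base pair \<open>(a, b)\<close>, so one goes from the first to the second through
  that base pair.
\<close>

lemma orbital_transitive: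
  assumes "\<Delta> \<in> orbitals n G" "(x, y) \<in> \<Delta>" "(x', y') \<in> \<Delta>"
  shows "\<exists>g\<in>G. g x = x' \<and> g y = y'"
  using assms(1)
proof (rule orbitalE)
  fix a b assume ab: "a \<in> Zset n" "b \<in> Zset n" and D: "\<Delta> = {(g a, g b) | g. g \<in> G}"
  obtain f where f: "f \<in> G" "x = f a" "y = f b" using assms(2) D by blast
  obtain g where g: "g \<in> G" "x' = g a" "y' = g b" using assms(3) D by blast
  obtain f' where f': "f' \<in> G" "\<forall>x\<in>Zset n. f' (f x) = x"
    using perm_group_inverse f(1) by blast
  have "compose (Zset n) g f' \<in> G"
    using perm_group_compose g(1) f'(1) by blast
  moreover have "compose (Zset n) g f' x = x'" "compose (Zset n) g f' y = y'"
    using f g f' ab perm_group_closed by (auto simp: compose_eq)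
  ultimately show ?thesis by blast
qed

end

section \<open>Automorphisms of a graph\<close>

lemma Aut_group: "group (Aut \<Gamma>)"
  using subgroup.subgroup_is_group[OF subgroup_Aut group_BijGroup]
  by (simp add: Aut_def)

lemma Aut_mult:
  "f \<in> carrier (Aut \<Gamma>) \<Longrightarrow> g \<in> carrier (Aut \<Gamma>) \<Longrightarrow> f \<otimes>\<^bsub>Aut \<Gamma>\<^esub> g = compose (verts \<Gamma>) f g"
  by (simp add: Aut_def BijGroup_def)

lemma Aut_action: "group_action (Aut \<Gamma>) (verts \<Gamma>) (\<lambda>f. f)"
  by (auto simp: group_action_def group_hom_def group_hom_axioms_def group_BijGroup Aut_group
      hom_def) (auto simp: Aut_def BijGroup_def)

lemma Aut_closed: "f \<in> carrier (Aut \<Gamma>) \<Longrightarrow> x \<in> verts \<Gamma> \<Longrightarrow> f x \<in> verts \<Gamma>"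
  using Bij_imp_funcset by (fastforce simp: Aut_def)

lemma Aut_image_edge:
  assumes "simple_graph \<Gamma>" "f \<in> carrier (Aut \<Gamma>)" "e \<in> edges \<Gamma>"
  shows "f ` e \<in> edges \<Gamma>"
proof -
  have "e \<subseteq> verts \<Gamma>" "card e = 2" using assms(1,3) by (auto simp: simple_graph_def)
  then obtain x y where "e = {x, y}" "x \<in> verts \<Gamma>" "y \<in> verts \<Gamma>"
    by (auto simp: card_2_iff)
  then show ?thesis using assms(2,3) by (simp add: Aut_def)
qed

section \<open>The action of \<open>G \<times> H \<times> K\<close> on the graph\<close>

locale orbital_graph =
  fixes n m t :: nat
    and G H K :: "(nat \<Rightarrow> nat) set"
    and \<Delta>1 \<Delta>2 \<Delta>3 \<Delta>4 \<Delta>5 :: "(nat \<times> nat) set"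
  assumes pos: "n > 0" "m > 0" "t > 0"
    and trG: "transitive_perm_group n G"
    and trH: "transitive_perm_group m H"
    and trK: "transitive_perm_group t K"
    and D1: "\<Delta>1 \<in> orbitals n G" "sym \<Delta>1"
    and D2: "\<Delta>2 \<in> orbitals n G" "sym \<Delta>2"
    and D3: "\<Delta>3 \<in> orbitals n G"
    and D4: "\<Delta>4 \<in> orbitals m H" "sym \<Delta>4"
    and D14: "\<Delta>1 = diagonal_orbital n \<longrightarrow> \<Delta>4 \<noteq> diagonal_orbital m"
    and D5: "\<Delta>5 \<in> orbitals t K" "sym \<Delta>5"
    and D25: "\<Delta>2 = diagonal_orbital n \<longrightarrow> \<Delta>5 \<noteq> diagonal_orbital t"
begin

abbreviation "V \<equiv> Vset n m"
abbreviation "U \<equiv> Uset n t"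
abbreviation "P \<equiv> perm_grp n G \<times>\<times> perm_grp m H \<times>\<times> perm_grp t K"
abbreviation "\<Gamma> \<equiv> Gamma n m t \<Delta>1 \<Delta>2 \<Delta>3 \<Delta>4 \<Delta>5"
abbreviation "act \<equiv> GHK_act n m t"

text \<open>The edge sets \<open>E\<^sub>1\<close>, \<open>E\<^sub>2\<close> and \<open>E\<^sub>3\<close>, named after the parts that contain the two ends.\<close>

definition "VV = {{Vv i j, Vv i' j'} | i j i' j'. (i, i') \<in> \<Delta>1 \<and> (j, j') \<in> \<Delta>4}"
definition "UU = {{Uu i j, Uu i' j'} | i j i' j'. (i, i') \<in> \<Delta>2 \<and> (j, j') \<in> \<Delta>5}"
definition "VU = {{Vv i j, Uu i' j'} | i j i' j'. (i, i') \<in> \<Delta>3 \<and> j \<in> Zset m \<and> j' \<in> Zset t}"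

lemma verts_Gamma: "verts \<Gamma> = V \<union> U"
  by (simp add: Gamma_def)

lemma edges_Gamma: "edges \<Gamma> = VV \<union> UU \<union> VU"
  by (simp add: Gamma_def VV_def UU_def VU_def)

lemma V_iff [simp]: "Vv i j \<in> V \<longleftrightarrow> i \<in> Zset n \<and> j \<in> Zset m" "Uu i j \<notin> V"
  by (auto simp: Vset_def)

lemma U_iff [simp]: "Uu i j \<in> U \<longleftrightarrow> i \<in> Zset n \<and> j \<in> Zset t" "Vv i j \<notin> U"
  by (auto simp: Uset_def)

lemma V_U_disjoint: "V \<inter> U = {}"
  by (auto simp: Vset_def)

lemma simple_Gamma: "simple_graph \<Gamma>"
  using simple_graph_Gamma trG trH trK D1(1) D2(1) D3 D4(1) D14 D5(1) D25 by blast

text \<open>Self-pairedness lets adjacency be read off from either ordering of the endpoints.\<close>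

lemma edge_iff:
  "{Vv i j, Vv i' j'} \<in> edges \<Gamma> \<longleftrightarrow> (i, i') \<in> \<Delta>1 \<and> (j, j') \<in> \<Delta>4"
  "{Uu i j, Uu i' j'} \<in> edges \<Gamma> \<longleftrightarrow> (i, i') \<in> \<Delta>2 \<and> (j, j') \<in> \<Delta>5"
  "{Vv i j, Uu i' j'} \<in> edges \<Gamma> \<longleftrightarrow> (i, i') \<in> \<Delta>3 \<and> j \<in> Zset m \<and> j' \<in> Zset t"
  "{Uu i' j', Vv i j} \<in> edges \<Gamma> \<longleftrightarrow> (i, i') \<in> \<Delta>3 \<and> j \<in> Zset m \<and> j' \<in> Zset t"
  using D1(2) D2(2) D4(2) D5(2)
  unfolding edges_Gamma VV_def UU_def VU_def by (auto simp: doubleton_eq_iff dest: symD)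

text \<open>
  The kind of an edge depends only on the parts that contain its endpoints, so an adjacency-preserving
  permutation that preserves \<open>V\<close> and \<open>U\<close> also preserves the three kinds.
\<close>

lemma edge_kinds:
  "VV = {e \<in> edges \<Gamma>. e \<subseteq> V}"
  "UU = {e \<in> edges \<Gamma>. e \<subseteq> U}"
  "VU = {e \<in> edges \<Gamma>. \<not> e \<subseteq> V \<and> \<not> e \<subseteq> U}"
proof -
  have VV: "e \<subseteq> V \<and> \<not> e \<subseteq> U" if "e \<in> VV" for e
    using that orbital_subset[OF trG D1(1)] orbital_subset[OF trH D4(1)] by (auto simp: VV_def)
  have UU: "\<not> e \<subseteq> V \<and> e \<subseteq> U" if "e \<in> UU" for e
    using that orbital_subset[OF trG D2(1)] orbital_subset[OF trK D5(1)] by (auto simp: UU_def)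
  have VU: "\<not> e \<subseteq> V \<and> \<not> e \<subseteq> U" if "e \<in> VU" for e
    using that by (auto simp: VU_def)
  show "VV = {e \<in> edges \<Gamma>. e \<subseteq> V}"
    unfolding edges_Gamma by (auto dest: VV UU VU)
  show "UU = {e \<in> edges \<Gamma>. e \<subseteq> U}"
    unfolding edges_Gamma by (auto dest: VV UU VU)
  show "VU = {e \<in> edges \<Gamma>. \<not> e \<subseteq> V \<and> \<not> e \<subseteq> U}"
    unfolding edges_Gamma by (auto dest: VV UU VU)
qed

lemma carrier_P: "carrier P = G \<times> H \<times> K"
  by (simp add: perm_grp_def)

lemma group_P: "group P"
  by (intro DirProd_group perm_grp_group[OF trG] perm_grp_group[OF trH] perm_grp_group[OF trK])

lemma act_simps [simp]:
  "i \<in> Zset n \<Longrightarrow> j \<in> Zset m \<Longrightarrow> act (g, h, k) (Vv i j) = Vv (g i) (h j)"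
  "i \<in> Zset n \<Longrightarrow> j' \<in> Zset t \<Longrightarrow> act (g, h, k) (Uu i j') = Uu (g i) (k j')"
  by (auto simp: GHK_act_def)

lemma vertex_cases:
  assumes "x \<in> verts \<Gamma>"
  obtains i j where "x = Vv i j" "i \<in> Zset n" "j \<in> Zset m"
  | i j where "x = Uu i j" "i \<in> Zset n" "j \<in> Zset t"
  using assms by (auto simp: verts_Gamma Vset_def Uset_def)

lemma act_closed:
  assumes "p \<in> carrier P" "x \<in> verts \<Gamma>"
  shows "act p x \<in> verts \<Gamma>"
  using assms(2,1) perm_group_closed[OF trG] perm_group_closed[OF trH] perm_group_closed[OF trK]
  by (cases rule: vertex_cases) (auto simp: verts_Gamma)

lemma act_mult:
  assumes "p \<in> carrier P" "q \<in> carrier P"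
  shows "act (p \<otimes>\<^bsub>P\<^esub> q) = compose (verts \<Gamma>) (act p) (act q)"
proof -
  obtain g h k g' h' k' where pq: "p = (g, h, k)" "q = (g', h', k')"
    by (cases p, cases q) auto
  have in_groups: "g \<in> G" "h \<in> H" "k \<in> K" "g' \<in> G" "h' \<in> H" "k' \<in> K"
    using assms pq by (auto simp: carrier_P)
  have prod: "p \<otimes>\<^bsub>P\<^esub> q = (compose (Zset n) g g', compose (Zset m) h h', compose (Zset t) k k')"
    using pq in_groups by (simp add: perm_grp_mult[OF trG] perm_grp_mult[OF trH] perm_grp_mult[OF trK])
  show ?thesis
  proof
    fix x
    show "act (p \<otimes>\<^bsub>P\<^esub> q) x = compose (verts \<Gamma>) (act p) (act q) x"
    proof (cases "x \<in> verts \<Gamma>")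
      case True
      then show ?thesis
        unfolding prod unfolding pq using in_groups
        by (cases rule: vertex_cases) (auto simp: compose_def verts_Gamma perm_group_closed[OF trG]
            perm_group_closed[OF trH] perm_group_closed[OF trK])
    next
      case False
      then show ?thesis
        unfolding prod by (simp add: compose_def GHK_act_def verts_Gamma)
    qed
  qed
qed

text \<open>
  The vertices \<open>v\<^sub>i\<^sup>j\<close> determine \<open>g\<close> and \<open>h\<close> because neither coordinate range is empty, and the
  vertices \<open>u\<^sub>0\<^sup>j\<close> determine \<open>k\<close>.
\<close>

lemma act_inj:
  assumes "p \<in> carrier P" "q \<in> carrier P" "\<And>x. x \<in> verts \<Gamma> \<Longrightarrow> act p x = act q x"
  shows "p = q"
proof -
  obtain g h k g' h' k' where pq: "p = (g, h, k)" "q = (g', h', k')"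
    by (cases p, cases q) auto
  have ext: "g \<in> extensional (Zset n)" "g' \<in> extensional (Zset n)"
    "h \<in> extensional (Zset m)" "h' \<in> extensional (Zset m)"
    "k \<in> extensional (Zset t)" "k' \<in> extensional (Zset t)"
    using assms(1,2) pq perm_group_subset[OF trG] perm_group_subset[OF trH]
      perm_group_subset[OF trK] by (auto simp: carrier_P intro!: Bij_imp_extensional)
  have zero: "0 \<in> Zset n" "0 \<in> Zset m" "0 \<in> Zset t"
    using pos by (simp_all add: Zset_def)
  have V: "g i = g' i \<and> h j = h' j" if "i \<in> Zset n" "j \<in> Zset m" for i j
    using assms(3)[of "Vv i j"] that by (simp add: pq verts_Gamma)
  have U: "k j = k' j" if "j \<in> Zset t" for j
    using assms(3)[of "Uu 0 j"] that zero by (simp add: pq verts_Gamma)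
  have "g = g'" using ext(1,2) V zero by (blast intro: extensionalityI)
  moreover have "h = h'" using ext(3,4) V zero by (blast intro: extensionalityI)
  moreover have "k = k'" using ext(5,6) U by (blast intro: extensionalityI)
  ultimately show ?thesis by (simp add: pq)
qed

lemma act_one: "x \<in> verts \<Gamma> \<Longrightarrow> act \<one>\<^bsub>P\<^esub> x = x"
  by (erule vertex_cases) (simp_all add: perm_grp_def BijGroup_def)

lemma act_Bij:
  assumes "p \<in> carrier P"
  shows "act p \<in> Bij (verts \<Gamma>)"
proof -
  interpret P: group P by (rule group_P)
  have inv: "inv\<^bsub>P\<^esub> p \<in> carrier P" using assms by (rule P.inv_closed)
  have cancel: "act a (act b x) = x"
    if "a \<in> carrier P" "b \<in> carrier P" "a \<otimes>\<^bsub>P\<^esub> b = \<one>\<^bsub>P\<^esub>" "x \<in> verts \<Gamma>" for a b x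
    using act_mult[OF that(1,2)] act_one[OF that(4)] that(3,4)
    by (metis compose_eq)
  have "bij_betw (act p) (verts \<Gamma>) (verts \<Gamma>)"
    by (rule bij_betw_byWitness[where f' = "act (inv\<^bsub>P\<^esub> p)"])
      (use assms inv cancel P.l_inv[OF assms] P.r_inv[OF assms] act_closed in blast)+
  moreover have "act p \<in> extensional (verts \<Gamma>)"
    by (cases p) (simp add: GHK_act_def verts_Gamma)
  ultimately show ?thesis by (simp add: Bij_def)
qed

lemma act_Aut:
  assumes "p \<in> carrier P"
  shows "act p \<in> carrier (Aut \<Gamma>)"
proof -
  obtain g h k where p: "p = (g, h, k)" "g \<in> G" "h \<in> H" "k \<in> K"
    using assms by (auto simp: carrier_P)
  note invariant = orbital_invariant[OF trG D1(1)] orbital_invariant[OF trG D2(1)]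
    orbital_invariant[OF trG D3] orbital_invariant[OF trH D4(1)] orbital_invariant[OF trK D5(1)]
  have "{x, y} \<in> edges \<Gamma> \<longleftrightarrow> {act p x, act p y} \<in> edges \<Gamma>"
    if "x \<in> verts \<Gamma>" "y \<in> verts \<Gamma>" for x y
    using that p perm_group_closed[OF trH] perm_group_closed[OF trK]
    by (auto elim!: vertex_cases simp: edge_iff invariant)
  then show ?thesis using act_Bij[OF assms] by (simp add: Aut_def)
qed

lemma GHK_act_mon: "act \<in> mon P (Aut \<Gamma>)"
proof -
  have "act \<in> hom P (Aut \<Gamma>)"
    by (rule homI) (simp_all only: act_Aut act_mult Aut_mult)
  moreover have "inj_on act (carrier P)"
    by (rule inj_onI) (metis act_inj)
  ultimately show ?thesis by (simp add: mon_def)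
qed

lemma GHK_image_subgroup: "subgroup (act ` carrier P) (Aut \<Gamma>)"
proof -
  have "group_hom P (Aut \<Gamma>) act"
    using GHK_act_mon group_P Aut_group
    by (simp add: group_hom_def group_hom_axioms_def mon_def)
  then show ?thesis by (rule group_hom.img_is_subgroup)
qed

section \<open>Orbits of \<open>G \<times> H \<times> K\<close>\<close>

lemma orbit_V:
  assumes "x \<in> V"
  shows "orbit P act x = V"
proof
  show "orbit P act x \<subseteq> V"
    using assms perm_group_closed[OF trG] perm_group_closed[OF trH]
    by (auto simp: orbit_def carrier_P Vset_def)
  show "V \<subseteq> orbit P act x"
  proof
    fix y assume "y \<in> V"
    with assms obtain i j i' j' where xy: "x = Vv i j" "y = Vv i' j'"
      "i \<in> Zset n" "i' \<in> Zset n" "j \<in> Zset m" "j' \<in> Zset m"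
      by (auto simp: Vset_def)
    obtain g h where "g \<in> G" "g i = i'" "h \<in> H" "h j = j'"
      using xy perm_group_transitive[OF trG] perm_group_transitive[OF trH] by blast
    moreover obtain k where "k \<in> K"
      using pos perm_group_transitive[OF trK, of 0 0] by (auto simp: Zset_def)
    ultimately have "(g, h, k) \<in> carrier P" "y = act (g, h, k) x"
      using xy by (simp_all add: carrier_P)
    then show "y \<in> orbit P act x" unfolding orbit_def by blast
  qed
qed

lemma orbit_U:
  assumes "x \<in> U"
  shows "orbit P act x = U"
proof
  show "orbit P act x \<subseteq> U"
    using assms perm_group_closed[OF trG] perm_group_closed[OF trK]
    by (auto simp: orbit_def carrier_P Uset_def)
  show "U \<subseteq> orbit P act x"
  proof
    fix y assume "y \<in> U"
    with assms obtain i j i' j' where xy: "x = Uu i j" "y = Uu i' j'"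
      "i \<in> Zset n" "i' \<in> Zset n" "j \<in> Zset t" "j' \<in> Zset t"
      by (auto simp: Uset_def)
    obtain g k where "g \<in> G" "g i = i'" "k \<in> K" "k j = j'"
      using xy perm_group_transitive[OF trG] perm_group_transitive[OF trK] by blast
    moreover obtain h where "h \<in> H"
      using pos perm_group_transitive[OF trH, of 0 0] by (auto simp: Zset_def)
    ultimately have "(g, h, k) \<in> carrier P" "y = act (g, h, k) x"
      using xy by (simp_all add: carrier_P)
    then show "y \<in> orbit P act x" unfolding orbit_def by blast
  qed
qed

lemma V_nonempty: "V \<noteq> {}" and U_nonempty: "U \<noteq> {}"
  using pos by (auto simp: Vset_def Uset_def Zset_def)

lemma orbits_GHK_verts: "orbits P (verts \<Gamma>) act = {V, U}"
  by (rule orbits_eqI) (use V_nonempty U_nonempty orbit_V orbit_U in \<open>auto simp: verts_Gamma\<close>)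

lemma card_vertex_parts: "card {V, U} = 2"
  using V_nonempty V_U_disjoint by (auto simp: card_insert_if)

text \<open>
  This bounds edge orbits from above. It is used twice: for \<open>G \<times> H \<times> K\<close>, which preserves \<open>V\<close> and
  \<open>U\<close> by construction, and for the full automorphism group when no automorphism fuses \<open>V\<close> and \<open>U\<close>.
\<close>

lemma edge_kind_preserved:
  assumes "f \<in> carrier (Aut \<Gamma>)" "f ` V \<subseteq> V" "f ` U \<subseteq> U"
    and "A \<in> {VV, UU, VU}" "e \<in> A"
  shows "f ` e \<in> A"
proof -
  have e: "e \<in> edges \<Gamma>" "e \<subseteq> V \<union> U"
    using assms(4,5) simple_Gamma unfolding simple_graph_def verts_Gamma edges_Gamma by blast+
  then have fe: "f ` e \<in> edges \<Gamma>"
    using Aut_image_edge[OF simple_Gamma assms(1)] by blast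
  have "f ` e \<subseteq> V \<longleftrightarrow> e \<subseteq> V" "f ` e \<subseteq> U \<longleftrightarrow> e \<subseteq> U"
    using assms(2,3) e(2) V_U_disjoint by blast+
  then show ?thesis
    using assms(4,5) e(1) fe unfolding edge_kinds by auto
qed

lemma act_preserves_parts:
  assumes "p \<in> carrier P"
  shows "act p ` V \<subseteq> V" "act p ` U \<subseteq> U"
proof -
  have "act p x \<in> orbit P act x" for x using assms unfolding orbit_def by blast
  then show "act p ` V \<subseteq> V" "act p ` U \<subseteq> U"
    using orbit_V orbit_U by (metis image_subsetI)+
qed

text \<open>
  For edges inside \<open>V\<close>, \<open>g\<close> moves the lower indices within \<open>\<Delta>1\<close> and \<open>h\<close> moves the upper indices
  within \<open>\<Delta>4\<close>. The two choices are independent, so a single element carries the whole edge. Edges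
  inside \<open>U\<close> are treated in the same way.
\<close>

lemma orbit_VV_superset:
  assumes "e \<in> VV"
  shows "VV \<subseteq> orbit P (\<lambda>p e. act p ` e) e"
proof
  fix e' assume "e' \<in> VV"
  with assms obtain a b a' b' c d c' d' where
    e: "e = {Vv a b, Vv a' b'}" "(a, a') \<in> \<Delta>1" "(b, b') \<in> \<Delta>4" and
    e': "e' = {Vv c d, Vv c' d'}" "(c, c') \<in> \<Delta>1" "(d, d') \<in> \<Delta>4"
    unfolding VV_def by blast
  have "a \<in> Zset n" "a' \<in> Zset n" "b \<in> Zset m" "b' \<in> Zset m"
    using e orbital_subset[OF trG D1(1)] orbital_subset[OF trH D4(1)] by auto
  moreover obtain g where "g \<in> G" "g a = c" "g a' = c'"
    using orbital_transitive[OF trG D1(1) e(2) e'(2)] by blast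
  moreover obtain h where "h \<in> H" "h b = d" "h b' = d'"
    using orbital_transitive[OF trH D4(1) e(3) e'(3)] by blast
  moreover obtain k where "k \<in> K"
    using pos perm_group_transitive[OF trK, of 0 0] by (auto simp: Zset_def)
  ultimately have "(g, h, k) \<in> carrier P" "e' = act (g, h, k) ` e"
    using e(1) e'(1) by (simp_all add: carrier_P)
  then show "e' \<in> orbit P (\<lambda>p e. act p ` e) e" unfolding orbit_def by blast
qed

lemma orbit_UU_superset:
  assumes "e \<in> UU"
  shows "UU \<subseteq> orbit P (\<lambda>p e. act p ` e) e"
proof
  fix e' assume "e' \<in> UU"
  with assms obtain a b a' b' c d c' d' where
    e: "e = {Uu a b, Uu a' b'}" "(a, a') \<in> \<Delta>2" "(b, b') \<in> \<Delta>5" and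
    e': "e' = {Uu c d, Uu c' d'}" "(c, c') \<in> \<Delta>2" "(d, d') \<in> \<Delta>5"
    unfolding UU_def by blast
  have "a \<in> Zset n" "a' \<in> Zset n" "b \<in> Zset t" "b' \<in> Zset t"
    using e orbital_subset[OF trG D2(1)] orbital_subset[OF trK D5(1)] by auto
  moreover obtain g where "g \<in> G" "g a = c" "g a' = c'"
    using orbital_transitive[OF trG D2(1) e(2) e'(2)] by blast
  moreover obtain k where "k \<in> K" "k b = d" "k b' = d'"
    using orbital_transitive[OF trK D5(1) e(3) e'(3)] by blast
  moreover obtain h where "h \<in> H"
    using pos perm_group_transitive[OF trH, of 0 0] by (auto simp: Zset_def)
  ultimately have "(g, h, k) \<in> carrier P" "e' = act (g, h, k) ` e"
    using e(1) e'(1) by (simp_all add: carrier_P)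
  then show "e' \<in> orbit P (\<lambda>p e. act p ` e) e" unfolding orbit_def by blast
qed

text \<open>
  The upper indices of the two ends of a mixed edge are moved by different factors \<open>h\<close> and \<open>k\<close>.
  Transitivity of \<open>H\<close> and \<open>K\<close> on points is therefore enough, which is why \<open>E\<^sub>3\<close> involves no orbital of \<open>H\<close> or \<open>K\<close>.
\<close>

lemma orbit_VU_superset:
  assumes "e \<in> VU"
  shows "VU \<subseteq> orbit P (\<lambda>p e. act p ` e) e"
proof
  fix e' assume "e' \<in> VU"
  with assms obtain a b a' b' c d c' d' where
    e: "e = {Vv a b, Uu a' b'}" "(a, a') \<in> \<Delta>3" "b \<in> Zset m" "b' \<in> Zset t" and
    e': "e' = {Vv c d, Uu c' d'}" "(c, c') \<in> \<Delta>3" "d \<in> Zset m" "d' \<in> Zset t"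
    unfolding VU_def by blast
  have "a \<in> Zset n" "a' \<in> Zset n"
    using e orbital_subset[OF trG D3] by auto
  moreover obtain g where "g \<in> G" "g a = c" "g a' = c'"
    using orbital_transitive[OF trG D3 e(2) e'(2)] by blast
  moreover obtain h where "h \<in> H" "h b = d"
    using perm_group_transitive[OF trH e(3) e'(3)] by blast
  moreover obtain k where "k \<in> K" "k b' = d'"
    using perm_group_transitive[OF trK e(4) e'(4)] by blast
  ultimately have "(g, h, k) \<in> carrier P" "e' = act (g, h, k) ` e"
    using e e'(1) by (simp_all add: carrier_P)
  then show "e' \<in> orbit P (\<lambda>p e. act p ` e) e" unfolding orbit_def by blast
qed

lemma orbit_edge_superset:
  assumes "A \<in> {VV, UU, VU}" "e \<in> A"
  shows "A \<subseteq> orbit P (\<lambda>p e. act p ` e) e"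
proof -
  consider "A = VV" | "A = UU" | "A = VU" using assms(1) by blast
  then show ?thesis
    using assms(2) orbit_VV_superset orbit_UU_superset orbit_VU_superset by cases simp_all
qed

lemma edge_kinds_nonempty: "VV \<noteq> {}" "UU \<noteq> {}" "VU \<noteq> {}"
proof -
  obtain a a' b b' c c' d d' e e' where
    "(a, a') \<in> \<Delta>1" "(b, b') \<in> \<Delta>2" "(c, c') \<in> \<Delta>3" "(d, d') \<in> \<Delta>4" "(e, e') \<in> \<Delta>5"
    using orbital_nonempty[OF trG D1(1)] orbital_nonempty[OF trG D2(1)]
      orbital_nonempty[OF trG D3] orbital_nonempty[OF trH D4(1)] orbital_nonempty[OF trK D5(1)]
    by (metis all_not_in_conv surj_pair)
  moreover have "0 \<in> Zset m" "0 \<in> Zset t" using pos by (simp_all add: Zset_def)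
  ultimately show "VV \<noteq> {}" "UU \<noteq> {}" "VU \<noteq> {}"
    unfolding VV_def UU_def VU_def by blast+
qed

lemma card_edge_kinds: "card {VV, UU, VU} = 3"
proof -
  have nonempty_edge: "e \<noteq> {}" if "e \<in> edges \<Gamma>" for e
    using that simple_Gamma by (auto simp: simple_graph_def)
  have "VV \<inter> UU = {}" "VV \<inter> VU = {}" "UU \<inter> VU = {}"
    unfolding edge_kinds using V_U_disjoint nonempty_edge by blast+
  then have "VV \<noteq> UU" "VV \<noteq> VU" "UU \<noteq> VU"
    using edge_kinds_nonempty by blast+
  then show ?thesis by simp
qed

lemma orbits_GHK_edges: "orbits P (edges \<Gamma>) (\<lambda>p e. act p ` e) = {VV, UU, VU}"
proof (rule orbits_eqI)
  show "\<Union>{VV, UU, VU} = edges \<Gamma>" by (simp add: edges_Gamma Un_assoc)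
  show "{} \<notin> {VV, UU, VU}" using edge_kinds_nonempty by simp
  fix A e assume A: "A \<in> {VV, UU, VU}" "e \<in> A"
  have "orbit P (\<lambda>p e. act p ` e) e \<subseteq> A"
  proof
    fix e' assume "e' \<in> orbit P (\<lambda>p e. act p ` e) e"
    then obtain p where "p \<in> carrier P" "e' = act p ` e" unfolding orbit_def by blast
    then show "e' \<in> A"
      using edge_kind_preserved[OF act_Aut act_preserves_parts A] by blast
  qed
  then show "orbit P (\<lambda>p e. act p ` e) e = A"
    using orbit_edge_superset[OF A] by (rule equalityI)
qed

section \<open>Orbits of the full automorphism group\<close>

lemma orbit_P_subset_orbit_Aut:
  "orbit P act x \<subseteq> orbit (Aut \<Gamma>) (\<lambda>f. f) x"
  "orbit P (\<lambda>p e. act p ` e) e \<subseteq> orbit (Aut \<Gamma>) (\<lambda>f e. f ` e) e"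
  by (rule orbit_mono_image[of act P "Aut \<Gamma>" "\<lambda>f. f"]
      orbit_mono_image[of act P "Aut \<Gamma>" "\<lambda>f e. f ` e"]; use act_Aut in blast)+

text \<open>
  Every vertex is reachable from \<open>x\<close>: those of \<open>V\<close> directly, those of \<open>U\<close> by way of \<open>f x\<close>.
\<close>

lemma o_v_fused:
  assumes "f \<in> carrier (Aut \<Gamma>)" "x \<in> V" "f x \<in> U"
  shows "o_v \<Gamma> = 1"
proof -
  interpret A: group_action "Aut \<Gamma>" "verts \<Gamma>" "\<lambda>f. f" by (rule Aut_action)
  let ?O = "orbit (Aut \<Gamma>) (\<lambda>f. f)"
  have in_verts: "x \<in> verts \<Gamma>" "f x \<in> verts \<Gamma>" using assms by (auto simp: verts_Gamma)
  have "f x \<in> ?O x" using assms(1) by (auto simp: orbit_def)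
  moreover have "y \<in> ?O x" if "y \<in> V" for y
    using orbit_P_subset_orbit_Aut(1)[of x] orbit_V[OF assms(2)] that by blast
  moreover have "y \<in> ?O (f x)" if "y \<in> U" for y
    using orbit_P_subset_orbit_Aut(1)[of "f x"] orbit_U[OF assms(3)] that by blast
  ultimately have from_x: "y \<in> ?O x" if "y \<in> verts \<Gamma>" for y
    using that in_verts A.orbit_trans[of x "f x" y] by (auto simp: verts_Gamma)
  have "?O y = verts \<Gamma>" if y: "y \<in> verts \<Gamma>" for y
  proof
    show "?O y \<subseteq> verts \<Gamma>" using Aut_closed y by (auto simp: orbit_def)
    show "verts \<Gamma> \<subseteq> ?O y"
      using A.orbit_trans[OF y in_verts(1)] A.orbit_sym[OF in_verts(1) y] from_x y by blast
  qed
  then have "orbits (Aut \<Gamma>) (verts \<Gamma>) (\<lambda>f. f) = {verts \<Gamma>}"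
    by (intro orbits_eqI) (use in_verts in auto)
  then show ?thesis by (simp add: o_v_def)
qed

text \<open>
  The hypothesis only speaks of passing from \<open>V\<close> to \<open>U\<close>. The other direction follows because the
  inverse of an automorphism taking \<open>u \<in> U\<close> into \<open>V\<close> would go from \<open>V\<close> to \<open>U\<close>.
\<close>

lemma Aut_preserves_parts:
  assumes no_swap: "\<not> (\<exists>f\<in>carrier (Aut \<Gamma>). \<exists>x\<in>V. f x \<in> U)"
    and f: "f \<in> carrier (Aut \<Gamma>)"
  shows "f ` V \<subseteq> V" "f ` U \<subseteq> U"
proof -
  interpret A: group_action "Aut \<Gamma>" "verts \<Gamma>" "\<lambda>f. f" by (rule Aut_action)
  show "f ` V \<subseteq> V"
    using assms Aut_closed[OF f] by (auto simp: verts_Gamma)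
  have "f u \<notin> V" if u: "u \<in> U" for u
  proof
    assume "f u \<in> V"
    have "u \<in> verts \<Gamma>" "f u \<in> verts \<Gamma>" "f u \<in> orbit (Aut \<Gamma>) (\<lambda>f. f) u"
      using u f Aut_closed[OF f] by (auto simp: verts_Gamma orbit_def)
    then have "u \<in> orbit (Aut \<Gamma>) (\<lambda>f. f) (f u)" by (rule A.orbit_sym)
    then obtain f' where "f' \<in> carrier (Aut \<Gamma>)" "u = f' (f u)" by (auto simp: orbit_def)
    then show False using no_swap \<open>f u \<in> V\<close> u by metis
  qed
  then show "f ` U \<subseteq> U"
    using Aut_closed[OF f] by (auto simp: verts_Gamma)
qed

text \<open>
  The subgroup \<open>G \<times> H \<times> K\<close> is already transitive on each of the five blocks, and no automorphism
  leaves a block.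
\<close>

lemma o_v_o_e_unfused:
  assumes "\<not> (\<exists>f\<in>carrier (Aut \<Gamma>). \<exists>x\<in>V. f x \<in> U)"
  shows "o_v \<Gamma> = 2" "o_e \<Gamma> = 3"
proof -
  note preserved = Aut_preserves_parts[OF assms]
  have "orbit (Aut \<Gamma>) (\<lambda>f. f) x = A" if "A \<in> {V, U}" "x \<in> A" for A x
  proof
    show "orbit (Aut \<Gamma>) (\<lambda>f. f) x \<subseteq> A"
      using that preserved unfolding orbit_def by blast
    show "A \<subseteq> orbit (Aut \<Gamma>) (\<lambda>f. f) x"
      using that orbit_V orbit_U orbit_P_subset_orbit_Aut(1)[of x] by blast
  qed
  then have "orbits (Aut \<Gamma>) (verts \<Gamma>) (\<lambda>f. f) = {V, U}"
    by (intro orbits_eqI) (use V_nonempty U_nonempty in \<open>auto simp: verts_Gamma\<close>)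
  then show "o_v \<Gamma> = 2" using card_vertex_parts by (simp add: o_v_def)
  have "orbits (Aut \<Gamma>) (edges \<Gamma>) (\<lambda>f e. f ` e) = {VV, UU, VU}"
  proof (rule orbits_eqI)
    show "\<Union>{VV, UU, VU} = edges \<Gamma>" by (simp add: edges_Gamma Un_assoc)
    show "{} \<notin> {VV, UU, VU}" using edge_kinds_nonempty by simp
    fix A e assume A: "A \<in> {VV, UU, VU}" "e \<in> A"
    have "orbit (Aut \<Gamma>) (\<lambda>f e. f ` e) e \<subseteq> A"
    proof
      fix e' assume "e' \<in> orbit (Aut \<Gamma>) (\<lambda>f e. f ` e) e"
      then obtain f where "f \<in> carrier (Aut \<Gamma>)" "e' = f ` e" unfolding orbit_def by blast
      then show "e' \<in> A" using edge_kind_preserved[OF _ preserved A] by blast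
    qed
    then show "orbit (Aut \<Gamma>) (\<lambda>f e. f ` e) e = A"
      using orbit_edge_superset[OF A] orbit_P_subset_orbit_Aut(2)[of e]
      by (meson equalityI subset_trans)
  qed
  then show "o_e \<Gamma> = 3" using card_edge_kinds by (simp add: o_e_def)
qed

end

theorem proposition3p4:
  fixes n m t :: nat
    and G H K :: "(nat \<Rightarrow> nat) set"
    and \<Delta>1 \<Delta>2 \<Delta>3 \<Delta>4 \<Delta>5 :: "(nat \<times> nat) set"
    and P :: "((nat \<Rightarrow> nat) \<times> (nat \<Rightarrow> nat) \<times> (nat \<Rightarrow> nat)) monoid"
    and \<Gamma> :: "vertex ugraph"
  assumes "n > 1" and "m \<ge> 1" and "t \<ge> 1"
    and "transitive_perm_group n G"
    and "transitive_perm_group m H"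
    and "transitive_perm_group t K"
    and "\<Delta>1 \<in> orbitals n G" and "sym \<Delta>1"
    and "\<Delta>2 \<in> orbitals n G" and "sym \<Delta>2"
    and "\<Delta>3 \<in> orbitals n G"
    and "\<Delta>4 \<in> orbitals m H" and "sym \<Delta>4"
    and "\<Delta>1 = diagonal_orbital n \<longrightarrow> \<Delta>4 \<noteq> diagonal_orbital m"
    and "\<Delta>5 \<in> orbitals t K" and "sym \<Delta>5"
    and "\<Delta>2 = diagonal_orbital n \<longrightarrow> \<Delta>5 \<noteq> diagonal_orbital t"
  defines "P \<equiv> perm_grp n G \<times>\<times> perm_grp m H \<times>\<times> perm_grp t K"
    and "\<Gamma> \<equiv> Gamma n m t \<Delta>1 \<Delta>2 \<Delta>3 \<Delta>4 \<Delta>5"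
  shows "(GHK_act n m t \<in> mon P (Aut \<Gamma>)
          \<and> subgroup (GHK_act n m t ` carrier P) (Aut \<Gamma>)
          \<and> card (orbits P (verts \<Gamma>) (GHK_act n m t)) = 2
          \<and> card (orbits P (edges \<Gamma>) (\<lambda>p e. GHK_act n m t p ` e)) = 3)
       \<and> (\<not> (o_v \<Gamma> = 2 \<and> o_e \<Gamma> = 3) \<longleftrightarrow>
            (\<exists>f\<in>carrier (Aut \<Gamma>). \<exists>x\<in>Vset n m. f x \<in> Uset n t))"
proof -
  interpret orbital_graph n m t G H K \<Delta>1 \<Delta>2 \<Delta>3 \<Delta>4 \<Delta>5
    using assms(1-17) by unfold_locales auto
  have "o_v \<Gamma> \<noteq> 2" if "\<exists>f\<in>carrier (Aut \<Gamma>). \<exists>x\<in>Vset n m. f x \<in> Uset n t"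
    using that o_v_fused unfolding \<Gamma>_def by fastforce
  moreover have "o_v \<Gamma> = 2" "o_e \<Gamma> = 3"
    if "\<not> (\<exists>f\<in>carrier (Aut \<Gamma>). \<exists>x\<in>Vset n m. f x \<in> Uset n t)"
    using o_v_o_e_unfused that unfolding \<Gamma>_def by blast+
  ultimately show ?thesis
    using GHK_act_mon GHK_image_subgroup orbits_GHK_verts card_vertex_parts
      orbits_GHK_edges card_edge_kinds
    unfolding P_def \<Gamma>_def by metis
qed

end
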